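(* Suppose that $A$ and $B$ are paramonotone. Then the following hold: (i) The sets of primal and dual solutions, $Z$ and $K$, are convex and closed. (ii) $\operatorname{gra}\mathbf{K}=\mathbf{S}$ and $\operatorname{gra}\mathbf{Z}$ are the rectangles $Z\times K$ and $K\times Z$, respectively; that is, $\operatorname{gra}\mathbf{K}=\mathbf{S}=Z\times K$ and $\operatorname{gra}\mathbf{Z}=K\times Z$. (iii) $\langle \overline{\operatorname{span}}(Z-Z),\overline{\operatorname{span}}(L^*K-L^*K)\rangle=0=\langle\overline{\operatorname{span}}(LZ-LZ),\overline{\operatorname{span}}(K-K)\rangle$, i.e., $\langle u,v\rangle=0$ for all $u\in\overline{\operatorname{span}}(Z-Z)$ and $v\in\overline{\operatorname{span}}(L^*K-L^*K)$, and likewise for the second pair of sets.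
   Context: $X$ and $Y$ are real Hilbert spaces, $L\colon X\to Y$ is continuous and linear with adjoint $L^*$, and $A\colon X\rightrightarrows X$ and $B\colon Y\rightrightarrows Y$ are maximally monotone set-valued operators (no maximal monotonicity of $A+L^*BL$ or $L^*BL$ is assumed). Inverses are in the sense of set-valued operators, and $L^{-*}:=(L^* )^{-1}$. The sets of primal and dual solutions are $$Z:=\{x\in X: 0\in Ax+L^*BLx\},\qquad K:=\{y\in Y: 0\in B^{-1}y-LA^{-1}(-L^*y)\}.$$ The set of saddle points is $\mathbf{S}:=\{(x,y)\in X\times Y: -L^*y\in Ax \text{ and } Lx\in B^{-1}y\}$. For $x\in X$ and $y\in Y$ set $K_x:=(-L^{-*}Ax)\cap(BLx)\subseteq Y$ and $Z_y:=(L^{-1}B^{-1}y)\cap A^{-1}(-L^*y)\subseteq X$. The set-valued operators $\mathbf{K}\colon X\rightrightarrows Y$ and $\mathbf{Z}\colon Y\rightrightarrows X$ are given by $\mathbf{K}(x)=K_x$ and $\mathbf{Z}(y)=Z_y$; $\operatorname{gra}$ denotes the graph. A monotone operator $A$ is paramonotone if $(x_0,u_0),(x_1,u_1)\in\operatorname{gra}A$ and $\langle x_0-x_1,u_0-u_1\rangle=0$ imply $(x_0,u_1)\in\operatorname{gra}A$ and $(x_1,u_0)\in\operatorname{gra}A$. *)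

theory Defs
  imports "HOL-Analysis.Analysis"
begin

text \<open>A set-valued operator from \<open>X\<close> to \<open>Y\<close> is a function \<open>'a \<Rightarrow> 'b set\<close>. A real Hilbert space is a
  type of sort \<open>{real_inner, complete_space}\<close>. On sets, \<open>+\<close> is the Minkowski sum, whereas \<open>-\<close> is
  set difference; hence the separate notation for the Minkowski difference.\<close>

definition minkowski_diff :: "'a::minus set \<Rightarrow> 'a set \<Rightarrow> 'a set"  (infixl "\<ominus>" 65)
  where "S \<ominus> T = {s - t | s t. s \<in> S \<and> t \<in> T}"

definition gra :: "('a \<Rightarrow> 'b set) \<Rightarrow> ('a \<times> 'b) set"
  where "gra A = {(x, u). u \<in> A x}"

definition inv_op :: "('a \<Rightarrow> 'b set) \<Rightarrow> 'b \<Rightarrow> 'a set"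
  where "inv_op A u = {x. u \<in> A x}"

definition monotone_op :: "('a::real_inner \<Rightarrow> 'a set) \<Rightarrow> bool"
  where "monotone_op A \<longleftrightarrow>
    (\<forall>x u y v. (x, u) \<in> gra A \<longrightarrow> (y, v) \<in> gra A \<longrightarrow> 0 \<le> inner (x - y) (u - v))"

definition maximally_monotone :: "('a::real_inner \<Rightarrow> 'a set) \<Rightarrow> bool"
  where "maximally_monotone A \<longleftrightarrow>
    monotone_op A \<and> (\<forall>A'. monotone_op A' \<longrightarrow> gra A \<subseteq> gra A' \<longrightarrow> gra A' = gra A)"

definition paramonotone :: "('a::real_inner \<Rightarrow> 'a set) \<Rightarrow> bool"
  where "paramonotone A \<longleftrightarrow> monotone_op A \<and>
    (\<forall>x0 u0 x1 u1. (x0, u0) \<in> gra A \<longrightarrow> (x1, u1) \<in> gra A \<longrightarrow> inner (x0 - x1) (u0 - u1) = 0 \<longrightarrow>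
      (x0, u1) \<in> gra A \<and> (x1, u0) \<in> gra A)"

definition primal_solutions ::
    "('a::real_inner \<Rightarrow> 'a set) \<Rightarrow> ('a \<Rightarrow> 'b::real_inner) \<Rightarrow> ('b \<Rightarrow> 'b set) \<Rightarrow> 'a set"
  where "primal_solutions A L B = {x. 0 \<in> A x + adjoint L ` B (L x)}"

definition dual_solutions ::
    "('a::real_inner \<Rightarrow> 'a set) \<Rightarrow> ('a \<Rightarrow> 'b::real_inner) \<Rightarrow> ('b \<Rightarrow> 'b set) \<Rightarrow> 'b set"
  where "dual_solutions A L B = {y. 0 \<in> inv_op B y \<ominus> L ` inv_op A (- adjoint L y)}"

definition saddle_points ::
    "('a::real_inner \<Rightarrow> 'a set) \<Rightarrow> ('a \<Rightarrow> 'b::real_inner) \<Rightarrow> ('b \<Rightarrow> 'b set) \<Rightarrow> ('a \<times> 'b) set"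
  where "saddle_points A L B = {(x, y). - adjoint L y \<in> A x \<and> L x \<in> inv_op B y}"

text \<open>The set inverses \<open>L\<^sup>-\<^sup>1\<close> and \<open>L\<^sup>-\<^sup>*\<close> of the single-valued maps \<open>L\<close> and \<open>L\<^sup>*\<close>, applied to sets,
  are preimages.\<close>

definition K_op ::
    "('a::real_inner \<Rightarrow> 'a set) \<Rightarrow> ('a \<Rightarrow> 'b::real_inner) \<Rightarrow> ('b \<Rightarrow> 'b set) \<Rightarrow> 'a \<Rightarrow> 'b set"
  where "K_op A L B x = uminus ` (adjoint L -` A x) \<inter> B (L x)"

definition Z_op ::
    "('a::real_inner \<Rightarrow> 'a set) \<Rightarrow> ('a \<Rightarrow> 'b::real_inner) \<Rightarrow> ('b \<Rightarrow> 'b set) \<Rightarrow> 'b \<Rightarrow> 'a set"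
  where "Z_op A L B y = L -` inv_op B y \<inter> inv_op A (- adjoint L y)"

end

theory Submission
  imports Defs
begin

text \<open>The proof rests on one identity. If \<open>(x\<^sub>0, y\<^sub>0)\<close> and \<open>(x\<^sub>1, y\<^sub>1)\<close> are saddle points, then the
  monotonicity gaps of \<open>A\<close> at \<open>(x\<^sub>i, - L\<^sup>* y\<^sub>i)\<close> and of \<open>B\<close> at \<open>(L x\<^sub>i, y\<^sub>i)\<close> are
  \<open>- \<langle>L x\<^sub>0 - L x\<^sub>1, y\<^sub>0 - y\<^sub>1\<rangle>\<close> and \<open>\<langle>L x\<^sub>0 - L x\<^sub>1, y\<^sub>0 - y\<^sub>1\<rangle>\<close>: they are nonnegative and add up to
  zero, so both vanish (\<open>saddle_gap_zero\<close>). Paramonotonicity then lets the two points exchange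
  their second components (\<open>saddle_swap\<close>), which says exactly that the saddle set is a rectangle.
  Its sides are the primal and the dual solutions, since \<open>0 \<in> A x + L\<^sup>* B L x\<close> asserts the
  existence of a \<open>y\<close> completing \<open>x\<close> to a saddle point, and symmetrically for \<open>y\<close>.

  Because of the rectangle, the vanishing gap holds for arbitrary pairs in \<open>Z\<close> and in \<open>K\<close>; this is
  the orthogonality of the differences, and orthogonality passes to closed linear spans
  (\<open>orthogonal_closure_span\<close>). Again by the rectangle, once some \<open>y \<in> K\<close> is fixed,
  \<open>Z\<close> is the section of the saddle set at \<open>y\<close>, an intersection of \<open>A\<^sup>-\<^sup>1 (- L\<^sup>* y)\<close> with a linear
  preimage of \<open>B\<^sup>-\<^sup>1 y\<close>. Values of maximally monotone operators and of their inverses are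
  intersections of closed half-spaces, so \<open>Z\<close> is closed and convex, and likewise \<open>K\<close>.

  The map \<open>adjoint L\<close> is a Hilbert choice from the maps satisfying the adjoint identity, so the
  existence of one has to be supplied; it comes from the Riesz representation theorem.\<close>

section \<open>Riesz representation and the adjoint\<close>

text \<open>The representing vector is the minimiser of the strictly convex functional
  \<open>q x = \<langle>x, x\<rangle> - 2 f x\<close>: the parallelogram law makes minimising sequences Cauchy, and the first
  variation of \<open>q\<close> at its minimiser gives the representation.\<close>

lemma riesz_representation:
  fixes f :: "'a::{real_inner, complete_space} \<Rightarrow> real"
  assumes f: "bounded_linear f"
  shows "\<exists>z. \<forall>x. f x = inner x z"
proof -
  interpret f: bounded_linear f by (rule f)
  define q where "q x = inner x x - 2 * f x" for x
  define m where "m = (INF x. q x)"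
  obtain C where C: "\<And>x. norm (f x) \<le> norm x * C"
    using f.bounded by blast
  have below: "- (C\<^sup>2) \<le> q x" for x
  proof -
    have "f x \<le> norm x * C" using C[of x] by simp
    moreover have "0 \<le> (norm x - C)\<^sup>2" by simp
    ultimately show ?thesis
      by (simp add: q_def power2_norm_eq_inner[symmetric] power2_diff)
  qed
  have bdd: "bdd_below (range q)"
    by (rule bdd_belowI2[of _ "- (C\<^sup>2)"]) (rule below)
  have m_le: "m \<le> q x" for x
    unfolding m_def by (rule cINF_lower[OF bdd]) simp
  have "\<exists>x. q x < m + 1 / real (Suc n)" for n
    using cINF_less_iff[OF _ bdd, of "m + 1 / real (Suc n)"] by (simp add: m_def)
  then obtain X where X: "\<And>n. q (X n) < m + 1 / real (Suc n)"
    by metis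
  have mid: "(norm (x - y))\<^sup>2 \<le> 2 * q x + 2 * q y - 4 * m" for x y
  proof -
    define c where "c = (1/2) *\<^sub>R (x + y)"
    have "q x + q y = 2 * q c + (norm (x - y))\<^sup>2 / 2"
      by (simp add: q_def c_def f.add f.scaleR power2_norm_eq_inner inner_add inner_diff
          inner_commute field_simps)
    then show ?thesis using m_le[of c] by (simp add: field_simps)
  qed
  have "Cauchy X"
  proof (rule metric_CauchyI)
    fix e :: real assume "0 < e"
    then obtain N where N: "inverse (real (Suc N)) < e\<^sup>2 / 4"
      using reals_Archimedean[of "e\<^sup>2 / 4"] by auto
    have close: "q (X n) - m < e\<^sup>2 / 4" if "n \<ge> N" for n
    proof -
      have "1 / real (Suc n) \<le> 1 / real (Suc N)"
        using that by (intro divide_left_mono) auto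
      then show ?thesis using X[of n] N by (simp add: inverse_eq_divide)
    qed
    have "dist (X i) (X j) < e" if "i \<ge> N" "j \<ge> N" for i j
    proof -
      have "(norm (X i - X j))\<^sup>2 < e\<^sup>2"
        using mid[of "X i" "X j"] close[OF that(1)] close[OF that(2)] by linarith
      then show ?thesis
        using \<open>0 < e\<close> by (simp add: dist_norm power_less_imp_less_base)
    qed
    then show "\<exists>N. \<forall>i\<ge>N. \<forall>j\<ge>N. dist (X i) (X j) < e" by blast
  qed
  then obtain z where z: "X \<longlonglongrightarrow> z"
    using Cauchy_convergent convergent_def by blast
  have "(\<lambda>n. q (X n)) \<longlonglongrightarrow> q z"
    unfolding q_def by (intro tendsto_intros z f.tendsto)
  moreover have "(\<lambda>n. m + 1 / real (Suc n)) \<longlonglongrightarrow> m + 0"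
    by (intro tendsto_intros LIMSEQ_inverse_real_of_nat[unfolded inverse_eq_divide])
  ultimately have "q z \<le> m + 0"
    by (rule LIMSEQ_le) (use X less_imp_le in blast)
  then have z_min: "q z \<le> q x" for x
    using m_le[of x] by simp
  have "f x = inner x z" for x
  proof (cases "x = 0")
    case True
    then show ?thesis by (simp add: f.zero)
  next
    case False
    define c where "c = f x - inner x z"
    define s where "s = inner x x"
    have s: "s > 0" using False by (simp add: s_def)
    have "q (z + t *\<^sub>R x) = q z - 2 * t * c + t * t * s" for t
      by (simp add: q_def c_def s_def f.add f.scaleR inner_add inner_commute algebra_simps)
    \<comment> \<open>The step length \<open>c / s\<close> minimises \<open>q\<close> along the line through \<open>z\<close> in direction \<open>x\<close>.\<close>
    then have "q (z + (c / s) *\<^sub>R x) = q z - 2 * (c / s) * c + (c / s) * (c / s) * s" .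
    also have "\<dots> = q z - c\<^sup>2 / s"
      using s by (simp add: power2_eq_square field_simps)
    finally have "c\<^sup>2 / s \<le> 0"
      using z_min[of "z + (c / s) *\<^sub>R x"] by linarith
    then have "c = 0"
      using s by (simp add: divide_le_0_iff)
    then show ?thesis by (simp add: c_def)
  qed
  then show ?thesis by blast
qed

lemma adjoint_inner:
  fixes L :: "'a::{real_inner, complete_space} \<Rightarrow> 'b::real_inner"
  assumes L: "bounded_linear L"
  shows "inner (L x) y = inner x (adjoint L y)"
proof -
  have "\<exists>z. \<forall>x. inner (L x) y = inner x z" for y
    by (rule riesz_representation)
      (rule bounded_linear_compose[OF bounded_linear_inner_left L, unfolded comp_def])
  then obtain L' where "\<forall>y x. inner (L x) y = inner x (L' y)"
    by metis
  then have "\<exists>L'. \<forall>x y. inner (L x) y = inner x (L' y)"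
    by blast
  then show ?thesis
    unfolding adjoint_def by (rule someI2_ex) blast
qed

lemma bounded_linear_adjoint:
  fixes L :: "'a::{real_inner, complete_space} \<Rightarrow> 'b::real_inner"
  assumes L: "bounded_linear L"
  shows "bounded_linear (adjoint L)"
proof -
  note adj = adjoint_inner[OF L, symmetric]
  obtain C where "0 \<le> C" and C: "\<And>x. norm (L x) \<le> norm x * C"
    using bounded_linear.nonneg_bounded[OF L] by blast
  show ?thesis
  proof (rule bounded_linear_intro)
    show "adjoint L (x + y) = adjoint L x + adjoint L y" for x y
      by (rule vector_eq_ldot[THEN iffD1]) (simp add: inner_add_right adj)
    show "adjoint L (r *\<^sub>R x) = r *\<^sub>R adjoint L x" for r x
      by (rule vector_eq_ldot[THEN iffD1]) (simp add: adj)
    show "norm (adjoint L y) \<le> norm y * C" for y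
    proof (cases "adjoint L y = 0")
      case True
      then show ?thesis using \<open>0 \<le> C\<close> by simp
    next
      case False
      have "norm (adjoint L y) * norm (adjoint L y) = inner (L (adjoint L y)) y"
        by (simp add: adjoint_inner[OF L] power2_norm_eq_inner[symmetric] power2_eq_square)
      also have "\<dots> \<le> norm (L (adjoint L y)) * norm y"
        by (rule norm_cauchy_schwarz)
      also have "\<dots> \<le> (norm (adjoint L y) * C) * norm y"
        by (intro mult_right_mono C) simp
      finally show ?thesis
        using mult_le_cancel_left_pos[of "norm (adjoint L y)"] False
        by (simp add: mult.assoc mult.commute[of C])
    qed
  qed
qed

section \<open>Values of maximally monotone operators\<close>

lemma monotone_opD:
  "monotone_op A \<Longrightarrow> u \<in> A x \<Longrightarrow> v \<in> A y \<Longrightarrow> 0 \<le> inner (x - y) (u - v)"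
  by (simp add: monotone_op_def gra_def)

text \<open>Maximality turns the graph into its own monotone polar: a point monotonically related to the
  whole graph could otherwise be added to it.\<close>

lemma maximally_monotone_mem_iff:
  assumes A: "maximally_monotone A"
  shows "u \<in> A x \<longleftrightarrow> (\<forall>(y, v) \<in> gra A. 0 \<le> inner (x - y) (u - v))"
proof
  assume "u \<in> A x"
  then show "\<forall>(y, v) \<in> gra A. 0 \<le> inner (x - y) (u - v)"
    using A by (auto simp: maximally_monotone_def monotone_op_def gra_def)
next
  assume polar: "\<forall>(y, v) \<in> gra A. 0 \<le> inner (x - y) (u - v)"
  define A' where "A' = A(x := insert u (A x))"
  have graph: "gra A' = insert (x, u) (gra A)"
    by (auto simp: A'_def gra_def split: if_splits)
  have "0 \<le> inner (y - x) (v - u)" if "(y, v) \<in> gra A" for y v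
  proof -
    have "inner (y - x) (v - u) = inner (x - y) (u - v)"
      by (metis inner_minus_left inner_minus_right minus_diff_eq)
    then show ?thesis using polar that by auto
  qed
  then have "monotone_op A'"
    using A polar unfolding monotone_op_def graph maximally_monotone_def
    by fastforce
  then have "gra A' = gra A"
    using A graph unfolding maximally_monotone_def by blast
  then have "(x, u) \<in> gra A" using graph by blast
  then show "u \<in> A x" by (simp add: gra_def)
qed

lemma maximally_monotone_value:
  fixes A :: "'a::real_inner \<Rightarrow> 'a set"
  assumes A: "maximally_monotone A"
  shows "convex (A x)" and "closed (A x)"
proof -
  have "A x = (\<Inter>(y, v) \<in> gra A. {u. inner (x - y) u \<ge> inner (x - y) v})"
    using maximally_monotone_mem_iff[OF A] by (auto simp: inner_diff_right)
  then show "convex (A x)" "closed (A x)"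
    by (auto intro!: convex_INT closed_INT convex_halfspace_ge closed_halfspace_ge)
qed

lemma maximally_monotone_inv_value:
  fixes A :: "'a::real_inner \<Rightarrow> 'a set"
  assumes A: "maximally_monotone A"
  shows "convex (inv_op A u)" and "closed (inv_op A u)"
proof -
  have "inv_op A u = (\<Inter>(y, v) \<in> gra A. {x. inner (u - v) x \<ge> inner (u - v) y})"
    using maximally_monotone_mem_iff[OF A]
    by (auto simp: inv_op_def inner_diff_left inner_diff_right inner_commute)
  then show "convex (inv_op A u)" "closed (inv_op A u)"
    by (auto intro!: convex_INT closed_INT convex_halfspace_ge closed_halfspace_ge)
qed

section \<open>Orthogonality of closed spans\<close>

text \<open>The vectors orthogonal to a fixed set form a closed subspace; this is applied once in each
  argument of the inner product.\<close>

lemma orthogonal_closure_span: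
  fixes S T :: "'a::real_inner set"
  assumes ST: "\<And>s t. s \<in> S \<Longrightarrow> t \<in> T \<Longrightarrow> inner s t = 0"
    and u: "u \<in> closure (span S)" and v: "v \<in> closure (span T)"
  shows "inner u v = 0"
proof -
  have half: "inner w t = 0"
    if "w \<in> closure (span U)" "\<And>s. s \<in> U \<Longrightarrow> inner s t = 0" for w t :: 'a and U
  proof -
    have "subspace {w. inner w t = 0}"
      by (auto simp: subspace_def inner_add_left)
    moreover have "closed {w. inner w t = 0}"
      by (intro closed_Collect_eq continuous_intros)
    ultimately have "closure (span U) \<subseteq> {w. inner w t = 0}"
      using that(2) by (intro closure_minimal span_minimal) auto
    then show ?thesis using that(1) by blast
  qed
  have "inner u t = 0" if "t \<in> T" for t
    using half[OF u] ST that by blast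
  then have "inner v u = 0"
    using half[OF v] by (simp add: inner_commute)
  then show ?thesis by (simp add: inner_commute)
qed

section \<open>The saddle set\<close>

lemma mem_saddle_points:
  "(x, y) \<in> saddle_points A L B \<longleftrightarrow> - adjoint L y \<in> A x \<and> y \<in> B (L x)"
  by (simp add: saddle_points_def inv_op_def)

lemma gra_K_op:
  assumes "linear (adjoint L)"
  shows "gra (K_op A L B) = saddle_points A L B"
proof -
  have "y \<in> uminus ` (adjoint L -` A x) \<longleftrightarrow> - adjoint L y \<in> A x" for x y
  proof -
    have "y \<in> uminus ` (adjoint L -` A x) \<longleftrightarrow> - y \<in> adjoint L -` A x"
      by (metis image_eqI image_iff minus_minus)
    then show ?thesis by (simp add: linear_neg[OF assms])
  qed
  then show ?thesis
    by (auto simp: gra_def K_op_def mem_saddle_points)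
qed

lemma gra_Z_op: "gra (Z_op A L B) = (saddle_points A L B)\<inverse>"
  by (auto simp: gra_def Z_op_def mem_saddle_points inv_op_def)

lemma primal_solutions_eq_Domain: "primal_solutions A L B = Domain (saddle_points A L B)"
proof -
  have "0 \<in> A x + adjoint L ` B (L x) \<longleftrightarrow> (\<exists>y. (x, y) \<in> saddle_points A L B)" for x
  proof -
    have "0 \<in> A x + adjoint L ` B (L x) \<longleftrightarrow> (\<exists>a\<in>A x. \<exists>y\<in>B (L x). a + adjoint L y = 0)"
      unfolding set_plus_def by force
    also have "\<dots> \<longleftrightarrow> (\<exists>y\<in>B (L x). - adjoint L y \<in> A x)"
      by (auto simp only: add_eq_0_iff2 Bex_def)
    finally show ?thesis by (auto simp: mem_saddle_points)
  qed
  then show ?thesis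
    by (simp add: primal_solutions_def set_eq_iff Domain_iff)
qed

lemma dual_solutions_eq_Range: "dual_solutions A L B = Range (saddle_points A L B)"
proof -
  have "0 \<in> inv_op B y \<ominus> L ` inv_op A (- adjoint L y) \<longleftrightarrow> (\<exists>x. (x, y) \<in> saddle_points A L B)" for y
  proof -
    have "0 \<in> inv_op B y \<ominus> L ` inv_op A (- adjoint L y) \<longleftrightarrow>
        (\<exists>x\<in>inv_op A (- adjoint L y). L x \<in> inv_op B y)"
      by (auto simp: minkowski_diff_def)
    then show ?thesis by (auto simp: mem_saddle_points inv_op_def)
  qed
  then show ?thesis
    by (simp add: dual_solutions_def set_eq_iff Range_iff)
qed

locale paramonotone_pair =
  fixes L :: "'a::{real_inner, complete_space} \<Rightarrow> 'b::{real_inner, complete_space}"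
    and A :: "'a \<Rightarrow> 'a set" and B :: "'b \<Rightarrow> 'b set"
  assumes L: "bounded_linear L"
    and A: "paramonotone A" and B: "paramonotone B"
begin

lemma saddle_gap_zero:
  assumes "(x0, y0) \<in> saddle_points A L B" and "(x1, y1) \<in> saddle_points A L B"
  shows "inner (L x0 - L x1) (y0 - y1) = 0"
proof -
  have memA: "- adjoint L y0 \<in> A x0" "- adjoint L y1 \<in> A x1"
    and memB: "y0 \<in> B (L x0)" "y1 \<in> B (L x1)"
    using assms by (simp_all add: mem_saddle_points)
  have "0 \<le> inner (x0 - x1) (- adjoint L y0 - - adjoint L y1)"
    using A memA by (intro monotone_opD) (simp_all add: paramonotone_def)
  also have "\<dots> = - inner (L x0 - L x1) (y0 - y1)"
    by (simp add: inner_diff adjoint_inner[OF L])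
  finally have "inner (L x0 - L x1) (y0 - y1) \<le> 0"
    by simp
  moreover have "0 \<le> inner (L x0 - L x1) (y0 - y1)"
    using B memB by (intro monotone_opD) (simp_all add: paramonotone_def)
  ultimately show ?thesis
    by simp
qed

lemma saddle_swap:
  assumes S: "(x0, y0) \<in> saddle_points A L B" "(x1, y1) \<in> saddle_points A L B"
  shows "(x0, y1) \<in> saddle_points A L B"
proof -
  have gap: "inner (L x0 - L x1) (y0 - y1) = 0"
    by (rule saddle_gap_zero[OF S])
  then have "inner (x0 - x1) (- adjoint L y0 - - adjoint L y1) = 0"
    by (simp add: inner_diff adjoint_inner[OF L])
  then have "- adjoint L y1 \<in> A x0"
    using A S unfolding paramonotone_def gra_def saddle_points_def by blast
  moreover have "y1 \<in> B (L x0)"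
    using B S gap unfolding paramonotone_def gra_def saddle_points_def inv_op_def by blast
  ultimately show ?thesis
    by (simp add: saddle_points_def inv_op_def)
qed

lemma saddle_points_rectangle:
  "saddle_points A L B = primal_solutions A L B \<times> dual_solutions A L B"
  unfolding primal_solutions_eq_Domain dual_solutions_eq_Range
  by (fast intro: saddle_swap)

lemma solutions_orthogonal:
  assumes "x0 \<in> primal_solutions A L B" "x1 \<in> primal_solutions A L B"
    and "y0 \<in> dual_solutions A L B" "y1 \<in> dual_solutions A L B"
  shows "inner (L x0 - L x1) (y0 - y1) = 0"
  using assms by (intro saddle_gap_zero) (simp_all add: saddle_points_rectangle)

end

text \<open>Each side of a nonempty saddle rectangle is the section of the saddle set at any fixed point
  of the other side, and a section is described by one value of each operator or of its inverse.\<close>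

lemma saddle_rectangle_sides_convex_closed:
  fixes L :: "'a::{real_inner, complete_space} \<Rightarrow> 'b::{real_inner, complete_space}"
  assumes L: "bounded_linear L"
    and mA: "maximally_monotone A" and mB: "maximally_monotone B"
    and rect: "saddle_points A L B = Z \<times> K" and empty: "Z = {} \<longleftrightarrow> K = {}"
  shows "convex Z" and "closed Z" and "convex K" and "closed K"
proof -
  have L': "bounded_linear (\<lambda>y. - adjoint L y)"
    by (intro bounded_linear_minus bounded_linear_adjoint L)
  have vimage: "convex (f -` C)" "closed (f -` C)"
    if f: "bounded_linear f" and "convex C" "closed C"
    for f :: "'c::real_normed_vector \<Rightarrow> 'd::real_normed_vector" and C
    using that
    by (auto intro!: convex_linear_vimage bounded_linear.linear closed_vimage linear_continuous_on)
  note val = maximally_monotone_value and inv = maximally_monotone_inv_value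
  have "convex Z \<and> closed Z \<and> convex K \<and> closed K"
  proof (cases "Z = {}")
    case True
    then show ?thesis using empty by simp
  next
    case False
    then obtain x y where x: "x \<in> Z" and y: "y \<in> K"
      using empty by blast
    have "Z = inv_op A (- adjoint L y) \<inter> L -` inv_op B y"
      using y rect by (auto simp: saddle_points_def inv_op_def set_eq_iff)
    moreover have "K = (\<lambda>y. - adjoint L y) -` A x \<inter> B (L x)"
      using x rect by (auto simp: saddle_points_def inv_op_def set_eq_iff)
    moreover have "convex (L -` inv_op B y)" "closed (L -` inv_op B y)"
      by (intro vimage[OF L] inv[OF mB])+
    moreover have "convex ((\<lambda>y. - adjoint L y) -` A x)" "closed ((\<lambda>y. - adjoint L y) -` A x)"
      by (intro vimage[OF L'] val[OF mA])+
    ultimately show ?thesis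
      using val[OF mB, of "L x"] inv[OF mA, of "- adjoint L y"]
      by (simp add: convex_Int closed_Int)
  qed
  then show "convex Z" "closed Z" "convex K" "closed K" by auto
qed

section \<open>Solution sets of paramonotone inclusions\<close>

theorem corollary5p3:
  fixes L :: "'a::{real_inner, complete_space} \<Rightarrow> 'b::{real_inner, complete_space}"
    and A :: "'a \<Rightarrow> 'a set" and B :: "'b \<Rightarrow> 'b set"
    and Z :: "'a set" and K :: "'b set"
  defines "Z \<equiv> primal_solutions A L B" and "K \<equiv> dual_solutions A L B"
  assumes "bounded_linear L"
    and "maximally_monotone A" and "maximally_monotone B"
    and "paramonotone A" and "paramonotone B"
  shows "(convex Z \<and> closed Z \<and> convex K \<and> closed K)
    \<and> (gra (K_op A L B) = saddle_points A L B \<and> saddle_points A L B = Z \<times> K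
        \<and> gra (Z_op A L B) = K \<times> Z)
    \<and> (\<forall>u \<in> closure (span (Z \<ominus> Z)). \<forall>v \<in> closure (span (adjoint L ` K \<ominus> adjoint L ` K)).
          inner u v = 0)
    \<and> (\<forall>u \<in> closure (span (L ` Z \<ominus> L ` Z)). \<forall>v \<in> closure (span (K \<ominus> K)). inner u v = 0)"
proof -
  interpret paramonotone_pair L A B
    by (rule paramonotone_pair.intro) (fact assms)+
  have rect: "saddle_points A L B = Z \<times> K"
    unfolding Z_def K_def by (rule saddle_points_rectangle)
  have "Z = {} \<longleftrightarrow> K = {}"
    by (auto simp: Z_def K_def primal_solutions_eq_Domain dual_solutions_eq_Range)
  then have "convex Z \<and> closed Z \<and> convex K \<and> closed K"
    using saddle_rectangle_sides_convex_closed[OF L assms(4,5) rect] by blast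
  moreover have "gra (K_op A L B) = saddle_points A L B"
    by (intro gra_K_op bounded_linear.linear bounded_linear_adjoint L)
  moreover have "gra (Z_op A L B) = K \<times> Z"
    by (auto simp: gra_Z_op rect)
  moreover have gap: "inner (L x0 - L x1) (y0 - y1) = 0"
    if "x0 \<in> Z" "x1 \<in> Z" "y0 \<in> K" "y1 \<in> K" for x0 x1 y0 y1
    using that unfolding Z_def K_def by (rule solutions_orthogonal)
  moreover have "inner u v = 0"
    if "u \<in> closure (span (L ` Z \<ominus> L ` Z))" "v \<in> closure (span (K \<ominus> K))" for u v
    by (rule orthogonal_closure_span[OF _ that]) (auto simp: minkowski_diff_def intro: gap)
  moreover have "inner (x0 - x1) (adjoint L y0 - adjoint L y1) = 0"
    if "x0 \<in> Z" "x1 \<in> Z" "y0 \<in> K" "y1 \<in> K" for x0 x1 y0 y1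
    using gap[OF that] by (simp add: inner_diff adjoint_inner[OF L])
  then have "inner u v = 0"
    if "u \<in> closure (span (Z \<ominus> Z))" "v \<in> closure (span (adjoint L ` K \<ominus> adjoint L ` K))" for u v
    by (intro orthogonal_closure_span[OF _ that]) (auto simp: minkowski_diff_def)
  ultimately show ?thesis
    using rect by blast
qed

end
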